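(* Let $h>0$, $\nu>0$ and $k\in\mathbb{Z}\setminus\{0\}$. If the divergence damping coefficient is $\alpha=0$, then the semi-discrete problem (SD) of the context is stable in the sense of the Godunov-Ryabenkii condition; that is, the associated eigenvalue problem (E) with boundary conditions (B) has no eigenvalue $s\in\mathbb{C}$ with $\Re(s)>0$.
   Context: Grid: $y_j=jh$, $j=0,1,2,\dots$. For a grid function $f_j$: $D_+f_j=(f_{j+1}-f_j)/h$, $D_-f_j=(f_j-f_{j-1})/h$, $D_0f_j=(f_{j+1}-f_{j-1})/(2h)$. Semi-discrete problem (SD), for complex grid functions $U_j(t),V_j(t),P_j(t)$ (a dot denotes $d/dt$), for $j>0$: $$\dot U_j=-ikP_j-\nu k^2U_j+\nu D_+D_-U_j+h^2F_u,\qquad \dot V_j=-D_0P_j-\nu k^2V_j+\nu D_+D_-V_j+h^2F_v,$$ $$-k^2P_j+D_+D_-P_j=\alpha ikU_j+\alpha D_0V_j+h^2F_p,$$ with boundary conditions $U_0=V_0=0$, $D_+P_0+\nu ikD_+U_0=h^rg_0$, where $F_u,F_v,F_p,g_0$ are given data and $r\in\{1,2\}$. Eigenvalue problem (E) (obtained by Laplace transforming the homogeneous version of (SD) in time, with dual variable $s$), for $j>0$: $$s\tilde U_j=-ik\tilde P_j-\nu k^2\tilde U_j+\nu D_+D_-\tilde U_j,\qquad s\tilde V_j=-D_0\tilde P_j-\nu k^2\tilde V_j+\nu D_+D_-\tilde V_j,$$ $$-k^2\tilde P_j+D_+D_-\tilde P_j=\alpha ik\tilde U_j+\alpha D_0\tilde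 V_j,$$ with the regularity condition $\|\tilde U\|_h,\|\tilde V\|_h,\|\tilde P\|_h<\infty$, where $\|f\|_h=\left(h\sum_{j\ge0}|f_j|^2\right)^{1/2}$. Boundary conditions (B): $\tilde U_0=\tilde V_0=0$ and $D_+\tilde P_0+\nu ikD_+\tilde U_0=0$. An eigenvalue is a number $s\in\mathbb{C}$ for which (E) with (B) has a solution $(\tilde U_j,\tilde V_j,\tilde P_j)_{j\ge0}$ that is not identically zero. (SD) is called stable in the sense of the Godunov-Ryabenkii condition if there is no eigenvalue $s$ with $\Re(s)>0$. *)

theory Defs
  imports Complex_Main "HOL-Library.Extended_Nonnegative_Real"
begin

text \<open>
  A grid function is a map \<^typ>\<open>nat \<Rightarrow> complex\<close>, whose value at \<open>j\<close> belongs to the grid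
  point \<open>y_j = j * h\<close>. The backward and central differences are meaningful only
  at interior points \<open>j > 0\<close>, since subtraction on natural numbers truncates at 0;
  below they are only ever evaluated there.
\<close>

definition D_plus :: "real \<Rightarrow> (nat \<Rightarrow> complex) \<Rightarrow> nat \<Rightarrow> complex" where
  "D_plus h f j = (f (j + 1) - f j) / of_real h"

definition D_minus :: "real \<Rightarrow> (nat \<Rightarrow> complex) \<Rightarrow> nat \<Rightarrow> complex" where
  "D_minus h f j = (f j - f (j - 1)) / of_real h"

definition D_zero :: "real \<Rightarrow> (nat \<Rightarrow> complex) \<Rightarrow> nat \<Rightarrow> complex" where
  "D_zero h f j = (f (j + 1) - f (j - 1)) / (2 * of_real h)"

text \<open>The discrete norm is extended-valued, so that its finiteness is a genuine condition.\<close>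

definition grid_norm :: "real \<Rightarrow> (nat \<Rightarrow> complex) \<Rightarrow> ennreal" where
  "grid_norm h f =
    (if summable (\<lambda>j. (cmod (f j))\<^sup>2) then ennreal (sqrt (h * (\<Sum>j. (cmod (f j))\<^sup>2))) else \<infinity>)"

definition eigen_equations ::
  "real \<Rightarrow> real \<Rightarrow> real \<Rightarrow> int \<Rightarrow> complex \<Rightarrow>
    (nat \<Rightarrow> complex) \<Rightarrow> (nat \<Rightarrow> complex) \<Rightarrow> (nat \<Rightarrow> complex) \<Rightarrow> bool" where
  "eigen_equations h \<nu> \<alpha> k s U V P \<longleftrightarrow>
    (\<forall>j>0.
      s * U j = - \<i> * of_int k * P j - of_real \<nu> * (of_int k)\<^sup>2 * U j
                  + of_real \<nu> * D_plus h (D_minus h U) j \<and>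
      s * V j = - D_zero h P j - of_real \<nu> * (of_int k)\<^sup>2 * V j
                  + of_real \<nu> * D_plus h (D_minus h V) j \<and>
      - (of_int k)\<^sup>2 * P j + D_plus h (D_minus h P) j
                = of_real \<alpha> * \<i> * of_int k * U j + of_real \<alpha> * D_zero h V j) \<and>
    grid_norm h U < \<infinity> \<and> grid_norm h V < \<infinity> \<and> grid_norm h P < \<infinity>"

definition boundary_conditions ::
  "real \<Rightarrow> real \<Rightarrow> int \<Rightarrow> (nat \<Rightarrow> complex) \<Rightarrow> (nat \<Rightarrow> complex) \<Rightarrow> (nat \<Rightarrow> complex) \<Rightarrow> bool" where
  "boundary_conditions h \<nu> k U V P \<longleftrightarrow>
    U 0 = 0 \<and> V 0 = 0 \<and> D_plus h P 0 + of_real \<nu> * \<i> * of_int k * D_plus h U 0 = 0"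

definition is_eigenvalue :: "real \<Rightarrow> real \<Rightarrow> real \<Rightarrow> int \<Rightarrow> complex \<Rightarrow> bool" where
  "is_eigenvalue h \<nu> \<alpha> k s \<longleftrightarrow>
    (\<exists>U V P. eigen_equations h \<nu> \<alpha> k s U V P \<and> boundary_conditions h \<nu> k U V P \<and>
       \<not> (\<forall>j. U j = 0 \<and> V j = 0 \<and> P j = 0))"

text \<open>
  The semi-discrete problem enters its Godunov-Ryabenkii stability only through the
  grid size \<open>h\<close>, the viscosity \<open>\<nu>\<close>, the damping coefficient \<open>\<alpha>\<close> and the wave number \<open>k\<close>:
  the eigenvalue problem is the Laplace transform in time of its homogeneous version.
\<close>

definition godunov_ryabenkii_stable :: "real \<Rightarrow> real \<Rightarrow> real \<Rightarrow> int \<Rightarrow> bool" where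
  "godunov_ryabenkii_stable h \<nu> \<alpha> k \<longleftrightarrow> \<not> (\<exists>s. is_eigenvalue h \<nu> \<alpha> k s \<and> Re s > 0)"

end

theory Submission imports Defs begin

text \<open>
  Without divergence damping the pressure decouples: it solves \<open>D\<^sub>+ D\<^sub>- P = k\<^sup>2 P\<close>, and
  square summability leaves only the geometric profile \<open>P\<^sub>j = P\<^sub>0 \<kappa>\<^sup>j\<close>, where \<open>\<kappa>\<close> is the
  root inside the unit disc of \<open>\<kappa> + 1/\<kappa> = 2 + h\<^sup>2 k\<^sup>2\<close>. The combination \<open>W = s U + \<i> k P\<close>
  removes the forcing from the momentum equation: it solves
  \<open>D\<^sub>+ D\<^sub>- W = (k\<^sup>2 + s/\<nu>) W\<close>, so \<open>W\<^sub>j = W\<^sub>0 \<mu>\<^sup>j\<close>, where \<open>\<mu>\<close> is the decaying root of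
  \<open>\<mu> + 1/\<mu> = 2 + h\<^sup>2 (k\<^sup>2 + s/\<nu>)\<close>. Since \<open>k \<noteq> 0\<close> and
  \<open>Re s > 0\<close>, both right-hand sides have real part above 2, so \<open>decaying_root_exists\<close>
  supplies the roots; the profiles come from \<open>decaying_grid_mode\<close>.

  The condition \<open>U\<^sub>0 = 0\<close> gives \<open>W\<^sub>0 = \<i> k P\<^sub>0\<close>, after which the pressure boundary
  condition reads \<open>P\<^sub>0 (s (\<kappa> - 1) - \<nu> k\<^sup>2 (\<mu> - \<kappa>)) = 0\<close>. By
  \<open>pressure_boundary_symbol_nonzero\<close> the second factor could vanish only if \<open>\<mu> = 1\<close>,
  which decay excludes. Hence \<open>P\<^sub>0 = 0\<close>; then \<open>P\<close> and \<open>W\<close> vanish, therefore also \<open>U\<close>, and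
  finally \<open>V\<close>, which solves the same equation as \<open>W\<close> with \<open>V\<^sub>0 = 0\<close>.
\<close>

lemma grid_norm_finite_tendsto_zero:
  assumes "grid_norm h f < \<infinity>"
  shows "f \<longlonglongrightarrow> 0"
proof -
  have "summable (\<lambda>j. (cmod (f j))\<^sup>2)"
    using assms unfolding grid_norm_def by (auto split: if_splits)
  then have "(\<lambda>j. (cmod (f j))\<^sup>2) \<longlonglongrightarrow> 0"
    by (rule summable_LIMSEQ_zero)
  then have "(\<lambda>j. sqrt ((cmod (f j))\<^sup>2)) \<longlonglongrightarrow> sqrt 0"
    by (rule tendsto_real_sqrt)
  then show ?thesis
    by (simp add: tendsto_norm_zero_iff)
qed

lemma D_plus_D_minus:
  "D_plus h (D_minus h f) j = (f (j + 1) - 2 * f j + f (j - 1)) / (of_real h)\<^sup>2"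
  by (cases "h = 0") (simp_all add: D_plus_def D_minus_def power2_eq_square divide_simps)

text \<open>
  The two roots of \<open>z\<^sup>2 - c z + 1\<close> are inverse to each other, so one of them decays
  unless both lie on the unit circle. In that case they are conjugate, and
  \<open>c = 2 Re z \<le> 2\<close>.
\<close>
lemma decaying_root_exists:
  fixes c :: complex
  assumes "Re c > 2"
  obtains z where "z \<noteq> 0" "cmod z < 1" "z + 1 / z = c"
proof -
  define m where "m = (c + csqrt (c\<^sup>2 - 4)) / 2"
  have "2 * m - c = csqrt (c\<^sup>2 - 4)"
    by (simp add: m_def field_simps)
  then have "(2 * m - c)\<^sup>2 = c\<^sup>2 - 4"
    by simp
  then have "4 * (m * m + 1) = 4 * (c * m)"
    by (simp add: power2_eq_square algebra_simps)
  then have eq: "m * m + 1 = c * m"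
    unfolding mult_cancel_left by simp
  then have nz: "m \<noteq> 0"
    by auto
  have sum: "m + 1 / m = c"
    using eq nz by (simp add: field_simps)
  have "cmod m \<noteq> 1"
  proof
    assume unit: "cmod m = 1"
    then have "1 / m = cnj m"
      using complex_div_cnj[of 1 m] by simp
    then have "c = m + cnj m"
      using sum by simp
    then have "Re c \<le> 2"
      using complex_Re_le_cmod[of m] unit by simp
    with assms show False
      by simp
  qed
  then have "cmod m < 1 \<or> cmod (1 / m) < 1"
    by (auto simp: norm_divide divide_less_eq)
  then consider "cmod m < 1" | "cmod (1 / m) < 1"
    by blast
  then show thesis
  proof cases
    case 1
    then show thesis
      using that nz sum by blast
  next
    case 2
    then show thesis
      using that[of "1 / m"] nz sum by (simp add: add.commute)
  qed
qed

text \<open>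
  The defect \<open>f\<^sub>j\<^sub>+\<^sub>1 - z f\<^sub>j\<close> from the decaying mode carries exactly the growing mode: it is
  multiplied by \<open>1/z\<close> in each step. A solution that tends to zero must therefore have
  defect zero.
\<close>
lemma decaying_grid_mode:
  assumes "h > 0" and "z \<noteq> 0" and "cmod z < 1"
    and symbol: "z + 1 / z = 2 + (of_real h)\<^sup>2 * l"
    and eq: "\<And>j. j > 0 \<Longrightarrow> D_plus h (D_minus h f) j = l * f j"
    and lim: "f \<longlonglongrightarrow> 0"
  shows "f j = f 0 * z ^ j"
proof -
  have rec: "f (Suc (Suc n)) = (z + 1 / z) * f (Suc n) - f n" for n
    using eq[of "Suc n"] \<open>h > 0\<close> unfolding symbol
    by (simp add: D_plus_D_minus field_simps)
  define g where "g n = f (Suc n) - z * f n" for n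
  have "z * g (Suc n) = g n" for n
    using \<open>z \<noteq> 0\<close> by (simp add: g_def rec field_simps)
  then have g0: "g 0 = z ^ n * g n" for n
    by (induction n) (auto simp: power_Suc2 mult.assoc simp del: power_Suc)
  have "g \<longlonglongrightarrow> 0 - z * 0"
    unfolding g_def by (intro tendsto_intros lim LIMSEQ_Suc)
  moreover have "(\<lambda>n. z ^ n) \<longlonglongrightarrow> 0"
    using \<open>cmod z < 1\<close> by (rule LIMSEQ_power_zero)
  ultimately have "(\<lambda>n. z ^ n * g n) \<longlonglongrightarrow> 0 * (0 - z * 0)"
    by (intro tendsto_mult)
  then have "g 0 = 0"
    using g0 LIMSEQ_unique[OF tendsto_const] by simp
  then have "g n = 0" for n
    using g0[of n] \<open>z \<noteq> 0\<close> by simp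
  then have "f (Suc n) = z * f n" for n
    by (simp add: g_def)
  then show ?thesis
    by (induction j) auto
qed

text \<open>
  Here \<open>\<kappa>\<close> is the decay rate of the pressure and \<open>\<mu>\<close> that of \<open>s U + \<i> k P\<close>, with \<open>K\<close> and
  \<open>\<sigma>\<close> standing for \<open>h\<^sup>2 k\<^sup>2\<close> and \<open>h\<^sup>2 s / \<nu>\<close>. The symbols give \<open>K = (1 - \<kappa>)\<^sup>2 / \<kappa>\<close> and
  \<open>\<sigma> = (\<kappa> - \<mu>) (1 - \<mu> \<kappa>) / (\<mu> \<kappa>)\<close>. If the stated difference vanished, the common
  factors \<open>1 - \<kappa>\<close> and \<open>\<kappa> - \<mu>\<close> would cancel and leave \<open>1 - \<mu> \<kappa> = \<mu> (1 - \<kappa>)\<close>, that is,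
  \<open>\<mu> = 1\<close>.
\<close>
lemma pressure_boundary_symbol_nonzero:
  fixes \<kappa> \<mu> K \<sigma> :: complex
  assumes "\<kappa> \<noteq> 0" "\<mu> \<noteq> 0" "\<kappa> \<noteq> 1" "\<mu> \<noteq> 1" "\<sigma> \<noteq> 0"
    and K: "\<kappa> + 1 / \<kappa> = 2 + K"
    and \<sigma>: "\<mu> + 1 / \<mu> = 2 + K + \<sigma>"
  shows "\<sigma> * (\<kappa> - 1) - K * (\<mu> - \<kappa>) \<noteq> 0"
proof
  assume zero: "\<sigma> * (\<kappa> - 1) - K * (\<mu> - \<kappa>) = 0"
  have K': "K = \<kappa> + 1 / \<kappa> - 2"
    using K by (simp add: algebra_simps)
  have \<sigma>': "\<sigma> = \<mu> + 1 / \<mu> - \<kappa> - 1 / \<kappa>"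
    using \<sigma> K' by (simp add: algebra_simps)
  then have "\<mu> \<noteq> \<kappa>"
    using \<open>\<sigma> \<noteq> 0\<close> by auto
  have "(\<sigma> * (\<kappa> - 1) - K * (\<mu> - \<kappa>)) * (\<mu> * \<kappa>) = (\<kappa> - \<mu>) * (\<kappa> - 1) * (1 - \<mu>)"
    unfolding K' \<sigma>' using \<open>\<kappa> \<noteq> 0\<close> \<open>\<mu> \<noteq> 0\<close>
    by (simp add: field_simps)
  then show False
    using zero \<open>\<mu> \<noteq> \<kappa>\<close> \<open>\<kappa> \<noteq> 1\<close> \<open>\<mu> \<noteq> 1\<close> by auto
qed

theorem proposition2:
  fixes h \<nu> \<alpha> :: real and k :: int
  assumes "h > 0" and "\<nu> > 0" and "k \<noteq> 0" and "\<alpha> = 0"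
  shows "godunov_ryabenkii_stable h \<nu> \<alpha> k"
proof -
  have trivial: "U j = 0 \<and> V j = 0 \<and> P j = 0"
    if "Re s > 0" and E: "eigen_equations h \<nu> \<alpha> k s U V P"
      and B: "boundary_conditions h \<nu> k U V P" for s U V P j
  proof -
    define K where "K = (of_int k :: complex)\<^sup>2"
    define W where "W j = s * U j + \<i> * of_int k * P j" for j
    have "s \<noteq> 0"
      using \<open>Re s > 0\<close> by auto
    have "\<nu> \<noteq> 0" "h \<noteq> 0"
      using assms by auto
    have Ueq: "s * U j = - \<i> * of_int k * P j - \<nu> * K * U j + \<nu> * D_plus h (D_minus h U) j"
      and Veq: "s * V j = - D_zero h P j - \<nu> * K * V j + \<nu> * D_plus h (D_minus h V) j"
      and Peq: "D_plus h (D_minus h P) j = K * P j"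
      if "j > 0" for j
      using E that \<open>\<alpha> = 0\<close> unfolding eigen_equations_def K_def by auto
    have lims: "U \<longlonglongrightarrow> 0" "V \<longlonglongrightarrow> 0" "P \<longlonglongrightarrow> 0"
      using E unfolding eigen_equations_def by (auto intro: grid_norm_finite_tendsto_zero)
    have bc: "U 0 = 0" "V 0 = 0" "D_plus h P 0 + \<nu> * \<i> * of_int k * D_plus h U 0 = 0"
      using B unfolding boundary_conditions_def by auto

    have K_real: "K = of_real ((of_int k)\<^sup>2)"
      by (simp add: K_def)
    have "Re ((of_real h)\<^sup>2 * K) = h\<^sup>2 * (of_int k)\<^sup>2"
      unfolding K_real by (simp flip: of_real_power)
    also have "\<dots> > 0"
      using assms by simp
    finally have K_pos: "Re ((of_real h)\<^sup>2 * K) > 0" .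
    have "Re ((of_real h)\<^sup>2 * (s / \<nu>)) = h\<^sup>2 * Re s / \<nu>"
      by (simp flip: of_real_power)
    also have "\<dots> > 0"
      using assms \<open>Re s > 0\<close> by simp
    finally have s_pos: "Re ((of_real h)\<^sup>2 * (s / \<nu>)) > 0" .

    obtain \<kappa> where \<kappa>: "\<kappa> \<noteq> 0" "cmod \<kappa> < 1" "\<kappa> + 1 / \<kappa> = 2 + (of_real h)\<^sup>2 * K"
      using decaying_root_exists[of "2 + (of_real h)\<^sup>2 * K"] K_pos by auto
    have "Re (2 + (of_real h)\<^sup>2 * (K + s / \<nu>)) > 2"
      using K_pos s_pos by (simp add: distrib_left)
    then obtain \<mu> where \<mu>: "\<mu> \<noteq> 0" "cmod \<mu> < 1"
      "\<mu> + 1 / \<mu> = 2 + (of_real h)\<^sup>2 * (K + s / \<nu>)"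
      by (rule decaying_root_exists)

    have P: "P j = P 0 * \<kappa> ^ j" for j
      by (rule decaying_grid_mode[OF \<open>h > 0\<close> \<kappa> Peq lims(3)])
    have "D_plus h (D_minus h W) j = (K + s / \<nu>) * W j" if "j > 0" for j
    proof -
      have U2: "D_plus h (D_minus h U) j = (W j + \<nu> * K * U j) / \<nu>"
        using Ueq[OF that] \<open>\<nu> \<noteq> 0\<close> by (simp add: W_def field_simps)
      have "D_plus h (D_minus h W) j
          = s * D_plus h (D_minus h U) j + \<i> * of_int k * D_plus h (D_minus h P) j"
        unfolding D_plus_D_minus W_def using \<open>h \<noteq> 0\<close> by (simp add: field_simps)
      also have "\<dots> = (K + s / \<nu>) * W j"
        unfolding U2 Peq[OF that] using \<open>\<nu> \<noteq> 0\<close> by (simp add: W_def field_simps)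
      finally show ?thesis .
    qed
    moreover have "W \<longlonglongrightarrow> s * 0 + \<i> * of_int k * 0"
      unfolding W_def by (intro tendsto_intros lims)
    ultimately have W: "W j = W 0 * \<mu> ^ j" for j
      using decaying_grid_mode[OF \<open>h > 0\<close> \<mu>] by simp

    have "P 0 = 0"
    proof -
      have sU1: "s * U 1 = \<i> * of_int k * P 0 * (\<mu> - \<kappa>)"
        using W[of 1] P[of 1] bc(1) by (simp add: W_def algebra_simps)
      have "(P 0 * (\<kappa> - 1) + \<nu> * \<i> * of_int k * U 1) / h = 0"
        using bc(3) P[of 1] bc(1)
        by (simp add: D_plus_def add_divide_distrib right_diff_distrib)
      then have "P 0 * (\<kappa> - 1) + \<nu> * \<i> * of_int k * U 1 = 0"
        using \<open>h \<noteq> 0\<close> by simp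
      then have "0 = s * (P 0 * (\<kappa> - 1) + \<nu> * \<i> * of_int k * U 1)"
        by simp
      also have "\<dots> = s * P 0 * (\<kappa> - 1) + \<nu> * \<i> * of_int k * (s * U 1)"
        by (simp add: algebra_simps)
      also have "\<dots> = P 0 * (s * (\<kappa> - 1) - \<nu> * K * (\<mu> - \<kappa>))"
        unfolding sU1 K_def by (simp add: algebra_simps power2_eq_square)
      finally have "P 0 * (s * (\<kappa> - 1) - \<nu> * K * (\<mu> - \<kappa>)) = 0"
        by simp
      moreover have "s * (\<kappa> - 1) - \<nu> * K * (\<mu> - \<kappa>) \<noteq> 0"
      proof -
        have "(of_real h)\<^sup>2 * (s / \<nu>) * (\<kappa> - 1) - (of_real h)\<^sup>2 * K * (\<mu> - \<kappa>) \<noteq> 0"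
          by (rule pressure_boundary_symbol_nonzero)
            (use \<kappa> \<mu> \<open>s \<noteq> 0\<close> \<open>\<nu> \<noteq> 0\<close> \<open>h \<noteq> 0\<close> in \<open>auto simp: distrib_left\<close>)
        also have "(of_real h)\<^sup>2 * (s / \<nu>) * (\<kappa> - 1) - (of_real h)\<^sup>2 * K * (\<mu> - \<kappa>)
            = (of_real h)\<^sup>2 / \<nu> * (s * (\<kappa> - 1) - \<nu> * K * (\<mu> - \<kappa>))"
          using \<open>\<nu> \<noteq> 0\<close> by (simp add: field_simps)
        finally show ?thesis
          by auto
      qed
      ultimately show ?thesis
        by simp
    qed
    then have P0: "P j = 0" for j
      using P[of j] by simp
    have "U j = 0" for j
      using W[of j] P0 bc(1) \<open>s \<noteq> 0\<close> by (simp add: W_def)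
    moreover have "V j = 0" for j
    proof -
      have "D_plus h (D_minus h V) j = (K + s / \<nu>) * V j" if "j > 0" for j
        using Veq[OF that] P0 \<open>\<nu> \<noteq> 0\<close> by (simp add: D_zero_def field_simps)
      then show ?thesis
        using decaying_grid_mode[OF \<open>h > 0\<close> \<mu> _ lims(2)] bc(2) by simp
    qed
    ultimately show ?thesis
      using P0 by simp
  qed
  then show ?thesis
    unfolding godunov_ryabenkii_stable_def is_eigenvalue_def by blast
qed

end
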